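(* For every $m\ge1$ there is a bijection between the set $\widehat{\mathcal{O}}(m)$ of ordered free multilabelled increasing trees with label set $\{1,\dots,m\}$ and the set $\widetilde{\mathcal{O}}(m)$ of ordered increasing trees with $m$ nodes in which each node of out-degree $1$ is coloured either black or white.
   Context: Ordered trees are rooted trees whose children of each node are linearly ordered. An ordered free multilabelled increasing tree with label set $\{1,\dots,m\}$ is an ordered tree together with an assignment of a non-empty set of labels to each node, these sets partitioning $\{1,\dots,m\}$, such that every label of a child is larger than every label of its parent. An ordered increasing tree with $m$ nodes is an ordered tree whose nodes carry the distinct labels $1,\dots,m$ such that each child has a larger label than its parent. *)

theory Defs
  imports Main "HOL-Library.Disjoint_Sets"
begin

datatype 'a otree = Node (root: 'a) (children: "'a otree list")

fun preorder :: "'a otree \<Rightarrow> 'a list" where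
  "preorder (Node x ts) = x # concat (map preorder ts)"

fun increasing_wrt :: "('a \<Rightarrow> 'a \<Rightarrow> bool) \<Rightarrow> 'a otree \<Rightarrow> bool" where
  "increasing_wrt R (Node x ts) \<longleftrightarrow> (\<forall>t\<in>set ts. R x (root t) \<and> increasing_wrt R t)"

(* Distinctness is needed on top of partition_on, which only sees the set of
   node labels and would let two nodes carry the same block. *)
definition free_multilabelled_increasing :: "nat \<Rightarrow> nat set otree \<Rightarrow> bool" where
  "free_multilabelled_increasing m t \<longleftrightarrow>
     distinct (preorder t) \<and>
     partition_on {1..m} (set (preorder t)) \<and>
     increasing_wrt (\<lambda>A B. \<forall>a\<in>A. \<forall>b\<in>B. a < b) t"

definition increasing_tree :: "nat \<Rightarrow> nat otree \<Rightarrow> bool" where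
  "increasing_tree m t \<longleftrightarrow>
     distinct (preorder t) \<and> set (preorder t) = {1..m} \<and> increasing_wrt (<) t"

datatype colour = Black | White

(* A node carries a colour iff its out-degree is 1; all other nodes carry None. *)
fun unary_coloured :: "('a \<times> colour option) otree \<Rightarrow> bool" where
  "unary_coloured (Node x ts) \<longleftrightarrow>
     (snd x \<noteq> None \<longleftrightarrow> length ts = 1) \<and> (\<forall>t\<in>set ts. unary_coloured t)"

definition O_hat :: "nat \<Rightarrow> nat set otree set" where
  "O_hat m = {t. free_multilabelled_increasing m t}"

definition O_tilde :: "nat \<Rightarrow> (nat \<times> colour option) otree set" where
  "O_tilde m = {t. increasing_tree m (map_otree fst t) \<and> unary_coloured t}"

end

theory Submission
  imports Defs
begin

text \<open>
  In a free multilabelled increasing tree, split each node with labels \<open>a\<^sub>1 < \<dots> < a\<^sub>k\<close> into a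
  path \<open>a\<^sub>1, \<dots>, a\<^sub>k\<close>, where \<open>a\<^sub>k\<close> inherits the children. The new edges are recorded by
  colouring their upper ends white; an original node of out-degree 1 yields a black \<open>a\<^sub>k\<close>.
  Contracting the edges below white nodes is the inverse. Neither map changes the sequence of
  labels read in preorder (sorted within each node), so the condition that the labels
  partition \<open>{1..m}\<close> is carried over.
\<close>

fun path_over :: "'a list \<Rightarrow> ('a \<times> colour option) otree list \<Rightarrow> ('a \<times> colour option) otree" where
  "path_over [] us = undefined"
| "path_over [a] us = Node (a, if length us = 1 then Some Black else None) us"
| "path_over (a # b # as) us = Node (a, Some White) [path_over (b # as) us]"

fun split_nodes :: "'a::linorder set otree \<Rightarrow> ('a \<times> colour option) otree" where
  "split_nodes (Node A ts) = path_over (sorted_list_of_set A) (map split_nodes ts)"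

definition insert_root :: "'a \<Rightarrow> 'a set otree \<Rightarrow> 'a set otree" where
  "insert_root a t = Node (insert a (root t)) (children t)"

text \<open>A white node of a \<open>unary_coloured\<close> tree has exactly one child, so
  \<open>hd\<close> picks that child. Applying \<open>map\<close> before \<open>hd\<close> keeps
  every recursive call on a member of \<open>ts\<close>, which gives termination.\<close>

fun contract_white :: "('a \<times> colour option) otree \<Rightarrow> 'a set otree" where
  "contract_white (Node x ts) =
     (if snd x = Some White then insert_root (fst x) (hd (map contract_white ts))
      else Node {fst x} (map contract_white ts))"

abbreviation set_less :: "'a::linorder set \<Rightarrow> 'a set \<Rightarrow> bool" where
  "set_less \<equiv> \<lambda>A B. \<forall>a\<in>A. \<forall>b\<in>B. a < b"

abbreviation label_less :: "'a::linorder \<times> 'b \<Rightarrow> 'a \<times> 'b \<Rightarrow> bool" where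
  "label_less \<equiv> \<lambda>x y. fst x < fst y"

text \<open>Since \<open>sorted_list_of_set\<close> is empty on infinite sets, both conditions serve
  to keep \<open>split_nodes\<close> away from the undefined case of
  \<open>path_over\<close>.\<close>

abbreviation finite_nonempty_labels :: "'a set otree \<Rightarrow> bool" where
  "finite_nonempty_labels t \<equiv> \<forall>A\<in>set (preorder t). finite A \<and> A \<noteq> {}"

definition label_sequence :: "'a::linorder set otree \<Rightarrow> 'a list" where
  "label_sequence t = concat (map sorted_list_of_set (preorder t))"

lemma label_sequence_Node:
  "label_sequence (Node A ts) = sorted_list_of_set A @ concat (map label_sequence ts)"
  by (simp add: label_sequence_def map_concat o_def) (induction ts; simp add: label_sequence_def)

lemma preorder_map_otree: "preorder (map_otree h t) = map h (preorder t)"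
  by (induction t) (simp add: map_concat o_def cong: map_cong)

lemma increasing_wrt_map_otree:
  "increasing_wrt R (map_otree h t) \<longleftrightarrow> increasing_wrt (\<lambda>x y. R (h x) (h y)) t"
  by (induction t) (simp add: otree.map_sel)

lemma sorted_list_of_set_insert_below:
  assumes "finite A" "\<forall>b\<in>A. a < b"
  shows "sorted_list_of_set (insert a A) = a # sorted_list_of_set A"
proof -
  have "a \<notin> A" using assms(2) by auto
  then have "sorted_list_of_set (insert a A) = insort a (sorted_list_of_set A)"
    using assms(1) by simp
  also have "\<dots> = a # sorted_list_of_set A"
    using assms by (intro insort_is_Cons) (auto intro: less_imp_le)
  finally show ?thesis .
qed

text \<open>The last node of the path is never white, so contraction stops there, whatever the
  colours in \<open>us\<close>; each earlier node is white and adds its label to the block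
  below.\<close>

lemma contract_white_path_over:
  "as \<noteq> [] \<Longrightarrow> contract_white (path_over as us) = Node (set as) (map contract_white us)"
  by (induction as us rule: path_over.induct) (auto simp: insert_root_def)

lemma contract_white_split_nodes:
  "finite_nonempty_labels t \<Longrightarrow> contract_white (split_nodes t) = t"
proof (induction t)
  case (Node A ts)
  then have "map (contract_white \<circ> split_nodes) ts = map id ts"
    by (intro map_cong) auto
  with Node.prems show ?case
    by (simp add: contract_white_path_over)
qed

lemma path_over_props:
  assumes "as \<noteq> []" "sorted_wrt (<) as"
    and "\<forall>u\<in>set us. unary_coloured u \<and> increasing_wrt label_less u \<and> (\<forall>a\<in>set as. a < fst (root u))"
  shows "unary_coloured (path_over as us) \<and> increasing_wrt label_less (path_over as us)
    \<and> fst (root (path_over as us)) = hd as"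
  using assms by (induction as us rule: path_over.induct) auto

text \<open>The third conjunct drives the induction: the root label of a split child lies in the
  child's block, hence exceeds every label of the parent, as \<open>path_over_props\<close>
  requires.\<close>

lemma split_nodes_props:
  assumes "finite_nonempty_labels t" "increasing_wrt set_less t"
  shows "unary_coloured (split_nodes t) \<and> increasing_wrt label_less (split_nodes t)
    \<and> fst (root (split_nodes t)) \<in> root t"
  using assms
proof (induction t)
  case (Node A ts)
  have A: "finite A" "A \<noteq> {}" using Node.prems by auto
  have IH: "unary_coloured (split_nodes t) \<and> increasing_wrt label_less (split_nodes t)
      \<and> fst (root (split_nodes t)) \<in> root t" if "t \<in> set ts" for t
    using that Node by auto
  have "unary_coloured (path_over (sorted_list_of_set A) (map split_nodes ts))
      \<and> increasing_wrt label_less (path_over (sorted_list_of_set A) (map split_nodes ts))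
      \<and> fst (root (path_over (sorted_list_of_set A) (map split_nodes ts))) = hd (sorted_list_of_set A)"
    using A IH Node.prems(2) by (intro path_over_props) auto
  moreover have "hd (sorted_list_of_set A) \<in> A"
    using A by (metis hd_in_set set_sorted_list_of_set sorted_list_of_set_eq_Nil_iff)
  ultimately show ?case by simp
qed

text \<open>The lower bound on the root block places the label of a white parent below the whole
  block. Sorting then lists this label first, which yields both the label sequence and the recovery
  of \<open>t\<close>.\<close>

lemma contract_white_props:
  assumes "unary_coloured t" "increasing_wrt label_less t"
  shows "finite_nonempty_labels (contract_white t) \<and> increasing_wrt set_less (contract_white t)
    \<and> (\<forall>a\<in>root (contract_white t). fst (root t) \<le> a)
    \<and> label_sequence (contract_white t) = map fst (preorder t)
    \<and> split_nodes (contract_white t) = t"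
  using assms
proof (induction t)
  case (Node x ts)
  have IH: "finite_nonempty_labels (contract_white t)" "increasing_wrt set_less (contract_white t)"
    "\<forall>a\<in>root (contract_white t). fst (root t) \<le> a"
    "label_sequence (contract_white t) = map fst (preorder t)"
    "split_nodes (contract_white t) = t" if "t \<in> set ts" for t
    using that Node by auto
  show ?case
  proof (cases "snd x = Some White")
    case True
    with Node.prems obtain t where ts: "ts = [t]"
      by (auto simp: length_Suc_conv)
    obtain A us where u: "contract_white t = Node A us"
      by (cases "contract_white t")
    note IH = IH[of t, unfolded ts u, simplified]
    have below: "\<forall>b\<in>A. fst x < b"
      using IH(3) Node.prems(2) ts by fastforce
    have A: "finite A" "A \<noteq> {}" using IH(1) by auto
    then obtain b bs where bs: "sorted_list_of_set A = b # bs"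
      by (metis list.exhaust sorted_list_of_set_eq_Nil_iff)
    \<comment> \<open>Any element of the non-empty \<open>A\<close> lies above \<open>fst x\<close>
      and below \<open>c\<close>.\<close>
    have incr: "\<forall>t\<in>set us. \<forall>c\<in>root t. fst x < c"
      using IH(2) A below by (meson all_not_in_conv less_trans)
    have eq: "contract_white (Node x ts) = Node (insert (fst x) A) us"
      using True ts u by (simp add: insert_root_def)
    have x: "x = (fst x, Some White)" using True by (metis prod.collapse)
    \<comment> \<open>With at least two entries in the list, the third equation of
      \<open>path_over\<close> applies and colours \<open>fst x\<close> white again.\<close>
    have sorted: "sorted_list_of_set (insert (fst x) A) = fst x # b # bs"
      using sorted_list_of_set_insert_below[OF A(1) below] bs by simp
    have "label_sequence (Node (insert (fst x) A) us) = map fst (preorder (Node x ts))"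
      using IH(4) by (simp add: label_sequence_Node sorted bs ts del: sorted_list_of_set_insert_remove)
    moreover have "split_nodes (Node (insert (fst x) A) us) = Node x ts"
      using IH(5) x by (simp add: sorted bs ts del: sorted_list_of_set_insert_remove)
    ultimately show ?thesis
      unfolding eq using IH(1,2) A below incr by (auto simp: less_imp_le)
  next
    case False
    have "\<forall>b\<in>root (contract_white t). fst x < b" if "t \<in> set ts" for t
      using IH(3)[OF that] Node.prems(2) that by fastforce
    moreover have "map (split_nodes \<circ> contract_white) ts = map id ts"
      using IH(5) by (intro map_cong) auto
    moreover have "concat (map (label_sequence \<circ> contract_white) ts) = concat (map (map fst \<circ> preorder) ts)"
      using IH(4) by (intro arg_cong[where f = concat] map_cong) auto
    \<comment> \<open>The colour of a root that is not white is determined by its out-degree, just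
      as the second equation of \<open>path_over\<close> assigns it.\<close>
    moreover have "(fst x, if length ts = 1 then Some Black else None) = x"
      using Node.prems(1) False by (cases x; cases "snd x"; cases "the (snd x)") auto
    ultimately show ?thesis
      using False IH(1,2) by (auto simp: label_sequence_Node map_concat)
  qed
qed

text \<open>A repeated non-empty block repeats a label, just as two overlapping blocks do, so
  distinctness of the concatenation encodes both distinctness of \<open>P\<close> and disjointness
  of its blocks.\<close>

lemma partition_on_iff_distinct_concat:
  assumes "finite S"
  shows "distinct P \<and> partition_on S (set P) \<longleftrightarrow>
    (\<forall>A\<in>set P. finite A \<and> A \<noteq> {}) \<and> distinct (concat (map sorted_list_of_set P))
    \<and> set (concat (map sorted_list_of_set P)) = S"
proof (cases "\<forall>A\<in>set P. finite A \<and> A \<noteq> {}")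
  case True
  have "distinct (concat (map sorted_list_of_set P)) \<longleftrightarrow> distinct P \<and> disjoint (set P)"
    using True
  proof (induction P)
    case (Cons A P)
    then have "A \<in> set P \<Longrightarrow> A \<inter> \<Union>(set P) \<noteq> {}" by auto
    with Cons show ?case
      by (auto simp: pairwise_insert disjnt_def)
  qed simp
  with True show ?thesis
    by (auto simp: partition_on_def)
next
  case False
  then show ?thesis
    using assms by (auto simp: partition_on_def intro: finite_subset)
qed

text \<open>Here and in \<open>mem_O_tilde_iff\<close> the labelling condition speaks only of a list
  of labels, which both maps preserve.\<close>

lemma mem_O_hat_iff:
  "t \<in> O_hat m \<longleftrightarrow> finite_nonempty_labels t \<and> increasing_wrt set_less t
     \<and> distinct (label_sequence t) \<and> set (label_sequence t) = {1..m}"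
  using partition_on_iff_distinct_concat[of "{1..m}" "preorder t"]
  by (auto simp: O_hat_def free_multilabelled_increasing_def label_sequence_def)

lemma mem_O_tilde_iff:
  "t \<in> O_tilde m \<longleftrightarrow> unary_coloured t \<and> increasing_wrt label_less t
     \<and> distinct (map fst (preorder t)) \<and> set (map fst (preorder t)) = {1..m}"
  by (auto simp: O_tilde_def increasing_tree_def preorder_map_otree increasing_wrt_map_otree)

theorem theorem7p3:
  fixes m :: nat
  assumes "m \<ge> 1"
  shows "\<exists>f. bij_betw f (O_hat m) (O_tilde m)"
proof
  show "bij_betw split_nodes (O_hat m) (O_tilde m)"
  proof (rule bij_betw_byWitness[where f' = contract_white])
    show "\<forall>t\<in>O_hat m. contract_white (split_nodes t) = t"
      by (auto simp: mem_O_hat_iff intro!: contract_white_split_nodes)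
    show "\<forall>t\<in>O_tilde m. split_nodes (contract_white t) = t"
      by (simp add: mem_O_tilde_iff contract_white_props)
    show "contract_white ` O_tilde m \<subseteq> O_hat m"
      using contract_white_props by (fastforce simp: mem_O_tilde_iff mem_O_hat_iff)
    show "split_nodes ` O_hat m \<subseteq> O_tilde m"
    proof (rule image_subsetI)
      fix t assume t: "t \<in> O_hat m"
      then have "unary_coloured (split_nodes t)" "increasing_wrt label_less (split_nodes t)"
        using split_nodes_props by (auto simp: mem_O_hat_iff)
      \<comment> \<open>No separate induction is needed: contracting \<open>split_nodes t\<close>
        preserves its label list and returns \<open>t\<close>.\<close>
      moreover from this have "map fst (preorder (split_nodes t)) = label_sequence t"
        using contract_white_props[of "split_nodes t"] contract_white_split_nodes[of t] t
        by (simp add: mem_O_hat_iff)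
      ultimately show "split_nodes t \<in> O_tilde m"
        using t by (simp only: mem_O_tilde_iff mem_O_hat_iff)
    qed
  qed
qed

end
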